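(* Let $X=\{a\}$ and let $\mathrm{FIM}$ be the monogenic free inverse monoid generated by $X$. Then $$\mathrm{ConjGeo}(\mathrm{FIM})=\mathrm{Geo}(\mathrm{FIM}),\qquad \mathrm{UConjGeo}(\mathrm{FIM})=\mathcal D\text{-}\mathrm{Geo}(\mathrm{FIM})\cup\{aa^{-1},a^{-1}a\},$$ and in particular $\mathrm{UConjGeo}(\mathrm{FIM})$ is a regular language.
   Context: All languages are over $\tilde X=\{a,a^{-1}\}$. $\tilde X^*$ is the free monoid on $\tilde X$, $\ell(w)$ is the length of a word $w$, and $\pi\colon \tilde X^*\to \mathrm{FIM}$ is the canonical surjective homomorphism. A word $w\in\tilde X^*$ is a geodesic if $\ell(w)\le \ell(u)$ for every $u\in \tilde X^*$ with $u\pi=w\pi$; $\mathrm{Geo}(\mathrm{FIM})$ is the set of all geodesics. Two elements $b,c$ of an inverse monoid $S$ are conjugate ($i$-conjugate) if there is $g\in S$ with $g^{-1}bg=c$ and $gcg^{-1}=b$. This is an equivalence relation; $[b]$ denotes the conjugacy class of $b$, called trivial if $[b]=\{b\}$. $\mathrm{ConjGeo}(\mathrm{FIM})=\{w\in \mathrm{Geo}(\mathrm{FIM}): \ell(w)\leq \ell(u)\text{ for all } u\in\tilde X^* \text{ such that } [w\pi]=[u\pi]\}$. $\mathrm{UConj}$ is the equivalence relation on $\mathrm{FIM}$ defined by: $(b,c)\in\mathrm{UConj}$ iff $b=c$, or both $[b]$ and $[c]$ are nontrivial. $\mathrm{UConjGeo}(\mathrm{FIM})=\{w\in\mathrm{Geo}(\mathrm{FIM}):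 \ell(w)\le\ell(u)\text{ for all }u\in\mathrm{Geo}(\mathrm{FIM})\text{ with }(w\pi,u\pi)\in\mathrm{UConj}\}$. $\mathcal D\text{-}\mathrm{Geo}(\mathrm{FIM})=\{w\in\tilde X^*:\ell(w)\le\ell(u)\text{ for all }u\in\tilde X^*\text{ with } w\pi\,\mathcal D\,u\pi\}$, where $\mathcal D$ is Green's $\mathcal D$-relation ($\mathcal D=\mathcal L\circ\mathcal R$, with $b\,\mathcal L\,c$ iff $b^{-1}b=c^{-1}c$ and $b\,\mathcal R\,c$ iff $bb^{-1}=cc^{-1}$). *)

theory Defs
  imports Main
begin

section \<open>Inverse monoids\<close>

class inverse_monoid = monoid_mult +
  fixes sinv :: "'a \<Rightarrow> 'a"
  assumes mult_sinv_mult: "x * sinv x * x = x"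
    and sinv_mult_sinv: "sinv x * x * sinv x = sinv x"
    and sinv_unique: "x * y * x = x \<Longrightarrow> y * x * y = y \<Longrightarrow> y = sinv x"

definition conjugate :: "'a::inverse_monoid \<Rightarrow> 'a \<Rightarrow> bool" where
  "conjugate b c \<longleftrightarrow> (\<exists>g. sinv g * b * g = c \<and> g * c * sinv g = b)"

definition conj_class :: "'a::inverse_monoid \<Rightarrow> 'a set" where
  "conj_class b = {c. conjugate b c}"

definition UConj :: "('a::inverse_monoid \<times> 'a) set" where
  "UConj = {(b, c). b = c \<or> (conj_class b \<noteq> {b} \<and> conj_class c \<noteq> {c})}"

definition green_L :: "('a::inverse_monoid \<times> 'a) set" where
  "green_L = {(b, c). sinv b * b = sinv c * c}"

definition green_R :: "('a::inverse_monoid \<times> 'a) set" where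
  "green_R = {(b, c). b * sinv b = c * sinv c}"

definition green_D :: "('a::inverse_monoid \<times> 'a) set" where
  "green_D = green_L O green_R"


section \<open>The monogenic free inverse monoid\<close>

text \<open>\<open>Gen\<close> and \<open>GenInv\<close> are the letters $a$ and $a^{-1}$.\<close>

datatype letter = Gen | GenInv

type_synonym word = "letter list"

fun letter_inv :: "letter \<Rightarrow> letter" where
  "letter_inv Gen = GenInv"
| "letter_inv GenInv = Gen"

definition word_inv :: "word \<Rightarrow> word" where
  "word_inv w = rev (map letter_inv w)"

text \<open>The Vagner congruence: the least monoid congruence on words whose quotient is an
  inverse monoid with inversion induced by \<^const>\<open>word_inv\<close>. Its quotient \<open>fim\<close> is the
  free inverse monoid on one generator.\<close>

inductive vagner :: "word \<Rightarrow> word \<Rightarrow> bool" where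
  vagner_inv: "vagner (u @ word_inv u @ u) u"
| vagner_comm: "vagner (u @ word_inv u @ v @ word_inv v) (v @ word_inv v @ u @ word_inv u)"
| vagner_refl: "vagner u u"
| vagner_sym: "vagner u v \<Longrightarrow> vagner v u"
| vagner_trans: "vagner u v \<Longrightarrow> vagner v w \<Longrightarrow> vagner u w"
| vagner_append: "vagner u v \<Longrightarrow> vagner u' v' \<Longrightarrow> vagner (u @ u') (v @ v')"

lemma letter_inv_letter_inv [simp]: "letter_inv (letter_inv x) = x"
  by (cases x) auto

lemma word_inv_word_inv [simp]: "word_inv (word_inv w) = w"
  by (simp add: word_inv_def rev_map comp_def)

lemma word_inv_append: "word_inv (u @ v) = word_inv v @ word_inv u"
  by (simp add: word_inv_def)

lemma vagner_word_inv: "vagner u v \<Longrightarrow> vagner (word_inv u) (word_inv v)"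
proof (induction rule: vagner.induct)
  case (vagner_inv u)
  show ?case
    using vagner.vagner_inv[of "word_inv u"] by (simp add: word_inv_append)
next
  case (vagner_comm u v)
  show ?case
    using vagner.vagner_comm[of v u] by (simp add: word_inv_append)
next
  case (vagner_append u v u' v')
  then show ?case
    by (simp add: word_inv_append vagner.vagner_append)
qed (blast intro: vagner.intros)+

quotient_type fim = word / vagner
  by (intro equivpI reflpI sympI transpI) (blast intro: vagner.intros)+

text \<open>The canonical surjection $\pi$ from words onto \<^typ>\<open>fim\<close>.\<close>

lift_definition proj :: "word \<Rightarrow> fim" is "\<lambda>w. w" .

instantiation fim :: inverse_monoid
begin

lift_definition one_fim :: fim is "[]" .

lift_definition times_fim :: "fim \<Rightarrow> fim \<Rightarrow> fim" is "(@)"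
  by (rule vagner_append)

lift_definition sinv_fim :: "fim \<Rightarrow> fim" is word_inv
  by (rule vagner_word_inv)

instance
proof
  fix x y z :: fim
  show assoc: "x * y * z = x * (y * z)" for x y z :: fim
    by transfer (simp add: vagner_refl)
  show "1 * x = x" "x * 1 = x"
    by (transfer, simp add: vagner_refl)+
  show inv1: "x * sinv x * x = x" for x :: fim
    by transfer (use vagner_inv in simp)
  have sinv_sinv: "sinv (sinv x) = x" for x :: fim
    by transfer (simp add: vagner_refl)
  show inv2: "sinv x * x * sinv x = sinv x" for x :: fim
    using inv1[of "sinv x"] by (simp add: sinv_sinv)
  have comm: "(x * sinv x) * (y * sinv y) = (y * sinv y) * (x * sinv x)" for x y :: fim
    by transfer (use vagner_comm in simp)
  have idem: "e = e * sinv e" if e: "e * e = e" for e :: fim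
  proof -
    have "e = e * sinv e * e"
      by (simp add: inv1)
    also have "\<dots> = e * (sinv e * e * sinv e) * e"
      by (simp add: inv2)
    also have "\<dots> = e * ((sinv e * e) * (e * sinv e)) * e"
      using e by (metis assoc)
    also have "\<dots> = e * ((e * sinv e) * (sinv e * e)) * e"
      using comm[of "sinv e" e] by (simp add: sinv_sinv)
    also have "\<dots> = (e * sinv e) * (sinv e * e)"
      using e by (metis assoc)
    also have "\<dots> = (sinv e * e) * (e * sinv e)"
      using comm[of "sinv e" e] by (simp add: sinv_sinv)
    also have "\<dots> = sinv e"
      using e inv2 by (metis assoc)
    finally show ?thesis
      using e by simp
  qed
  have idem_comm: "e * f = f * e" if "e * e = e" "f * f = f" for e f :: fim
    using comm[of e f] idem[OF that(1)] idem[OF that(2)] by simp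
  show "y = sinv x" if y: "x * y * x = x" "y * x * y = y" for x y :: fim
  proof -
    let ?z = "sinv x"
    have i: "(x * y) * (x * y) = x * y" "(y * x) * (y * x) = y * x"
      "(x * ?z) * (x * ?z) = x * ?z" "(?z * x) * (?z * x) = ?z * x"
      using y inv1[of x] by (metis assoc)+
    have "y = y * (x * ?z * x) * y"
      using y inv1 by simp
    also have "\<dots> = (y * x) * (?z * x) * y"
      by (simp add: assoc)
    also have "\<dots> = (?z * x) * (y * x) * y"
      using idem_comm i by simp
    also have "\<dots> = ?z * x * y"
      using y by (metis assoc)
    finally have l: "y = ?z * x * y" .
    have "?z = ?z * (x * y * x) * ?z"
      using y inv2 by simp
    also have "\<dots> = ?z * ((x * y) * (x * ?z))"
      by (simp add: assoc)
    also have "\<dots> = ?z * ((x * ?z) * (x * y))"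
      using idem_comm i by simp
    also have "\<dots> = ?z * x * y"
      using inv2[of x] by (metis assoc)
    finally show ?thesis
      using l by simp
  qed
qed

end

lemma proj_Nil: "proj [] = 1"
  by transfer (rule vagner_refl)

lemma proj_append: "proj (u @ v) = proj u * proj v"
  by transfer (rule vagner_refl)

lemma proj_word_inv: "proj (word_inv w) = sinv (proj w)"
  by transfer (rule vagner_refl)

lemma proj_eq_iff: "proj u = proj v \<longleftrightarrow> vagner u v"
  by transfer simp

lemma surj_proj: "surj proj"
proof (rule surjI)
  show "proj (rep_fim x) = x" for x
    by (simp add: proj_def Quotient3_abs_rep[OF Quotient3_fim])
qed


section \<open>Languages of geodesics\<close>

definition Geo :: "word set" where
  "Geo = {w. \<forall>u. proj u = proj w \<longrightarrow> length w \<le> length u}"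

definition ConjGeo :: "word set" where
  "ConjGeo = {w \<in> Geo. \<forall>u. conj_class (proj w) = conj_class (proj u) \<longrightarrow> length w \<le> length u}"

definition UConjGeo :: "word set" where
  "UConjGeo = {w \<in> Geo. \<forall>u \<in> Geo. (proj w, proj u) \<in> UConj \<longrightarrow> length w \<le> length u}"

definition DGeo :: "word set" where
  "DGeo = {w. \<forall>u. (proj w, proj u) \<in> green_D \<longrightarrow> length w \<le> length u}"

text \<open>Recognisability by a complete deterministic finite automaton; taking the states to be
  natural numbers is no restriction, as they form a finite set.\<close>

definition regular_language :: "word set \<Rightarrow> bool" where
  "regular_language L \<longleftrightarrow>
    (\<exists>(Q :: nat set) (\<delta> :: nat \<Rightarrow> letter \<Rightarrow> nat) q0 F.
      finite Q \<and> q0 \<in> Q \<and> F \<subseteq> Q \<and> (\<forall>q \<in> Q. \<forall>x. \<delta> q x \<in> Q) \<and>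
      L = {w. foldl \<delta> q0 w \<in> F})"

end

theory Submission
  imports Defs
begin

text \<open>A word is read as a walk on the integers starting at 0; the highest and lowest points
  visited and the end point depend only on the element of the free inverse monoid. If
  \<open>j\<close> is the width of the range and \<open>d\<close> the end point, the word has length at least
  \<open>2 j - \<bar>d\<bar>\<close>. Every element is represented by a word \<open>y\<^sup>i x\<^sup>j y\<^sup>k\<close> with
  \<open>{x, y} = {a, a\<^sup>-\<^sup>1}\<close> and \<open>i + k \<le> j\<close>, for which this bound is attained.
  Conjugation by \<open>g\<close> only translates the range, so it keeps the width and the end point, hence the
  geodesic length. A class is nontrivial exactly when \<open>i + k > 0\<close>; then \<open>i + j + k \<ge> 2\<close>, with
  equality only for the two exceptional words. The \<open>\<D>\<close>-classes are determined by the width, and the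
  shortest words of width \<open>j\<close> are \<open>a\<^sup>j\<close> and \<open>a\<^sup>-\<^sup>j\<close>.\<close>

section \<open>Words as walks on the integers\<close>

fun step :: "letter \<Rightarrow> int" where
  "step Gen = 1"
| "step GenInv = -1"

definition endpt :: "word \<Rightarrow> int" where
  "endpt w = sum_list (map step w)"

fun hi :: "word \<Rightarrow> int" where
  "hi [] = 0"
| "hi (x # w) = max 0 (step x + hi w)"

fun lo :: "word \<Rightarrow> int" where
  "lo [] = 0"
| "lo (x # w) = min 0 (step x + lo w)"

abbreviation width :: "word \<Rightarrow> int" where
  "width w \<equiv> hi w - lo w"

lemma step_letter_inv [simp]: "step (letter_inv x) = - step x"
  by (cases x) auto

lemma endpt_simps [simp]:
  "endpt [] = 0" "endpt (x # w) = step x + endpt w" "endpt (u @ v) = endpt u + endpt v"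
  by (simp_all add: endpt_def)

lemma endpt_word_inv [simp]: "endpt (word_inv w) = - endpt w"
  by (induction w) (simp_all add: word_inv_def)

lemma hi_append [simp]: "hi (u @ v) = max (hi u) (endpt u + hi v)"
proof (induction u)
  case Nil
  show ?case by (cases v) auto
qed (auto simp: max_def)

lemma lo_append [simp]: "lo (u @ v) = min (lo u) (endpt u + lo v)"
proof (induction u)
  case Nil
  show ?case by (cases v) auto
qed (auto simp: min_def)

lemma walk_bounds: "lo w \<le> 0" "0 \<le> hi w" "lo w \<le> endpt w" "endpt w \<le> hi w"
proof -
  show "lo w \<le> 0" "0 \<le> hi w"
    by (cases w; simp)+
  show "lo w \<le> endpt w" "endpt w \<le> hi w"
    by (induction w) auto
qed

lemma word_inv_Cons: "word_inv (x # w) = word_inv w @ [letter_inv x]"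
  by (simp add: word_inv_def)

lemma hi_word_inv [simp]: "hi (word_inv w) = hi w - endpt w"
proof (induction w)
  case (Cons x w)
  then show ?case
    using walk_bounds[of w] by (cases x) (auto simp: word_inv_Cons)
qed (simp add: word_inv_def)

lemma lo_word_inv [simp]: "lo (word_inv w) = lo w - endpt w"
proof (induction w)
  case (Cons x w)
  then show ?case
    using walk_bounds[of w] by (cases x) (auto simp: word_inv_Cons)
qed (simp add: word_inv_def)

text \<open>The walk of \<open>u @ word_inv u @ u\<close> only retraces that of \<open>u\<close>;
  \<open>u @ word_inv u\<close> is a closed walk with the range of \<open>u\<close>, and
  concatenating two closed walks takes the union of their ranges.\<close>

lemma vagner_walk: "vagner u v \<Longrightarrow> endpt u = endpt v \<and> hi u = hi v \<and> lo u = lo v"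
proof (induction rule: vagner.induct)
  case (vagner_inv u)
  then show ?case using walk_bounds[of u] by auto
next
  case (vagner_comm u v)
  then show ?case using walk_bounds[of u] walk_bounds[of v] by auto
qed auto

lemma proj_walk:
  assumes "proj u = proj v"
  shows "endpt u = endpt v" "hi u = hi v" "lo u = lo v"
  using vagner_walk assms by (auto simp: proj_eq_iff)

section \<open>Length bounds from range and end point\<close>

text \<open>A last letter either keeps the range and changes the absolute end point by one, or
  leaves the range at an extreme, where width and absolute end point both grow by one.\<close>

lemma length_lower_bound: "2 * width w - \<bar>endpt w\<bar> \<le> int (length w)"
proof (induction w rule: rev_induct)
  case (snoc x w)
  then show ?case
    using walk_bounds[of w] by (cases x) (auto simp: max_def min_def abs_if split: if_splits)
qed simp

lemma width_le_length: "width w \<le> int (length w)"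
proof -
  have "\<bar>endpt w\<bar> \<le> width w"
    using walk_bounds[of w] by (simp add: abs_le_iff)
  then show ?thesis
    using length_lower_bound[of w] by simp
qed

lemma abs_endpt_le_length: "\<bar>endpt w\<bar> \<le> int (length w)"
  using width_le_length[of w] walk_bounds[of w] by (simp add: abs_le_iff)

lemma eq_replicate_if_endpt:
  "endpt w = step x * int (length w) \<Longrightarrow> w = replicate (length w) x"
proof (induction w)
  case (Cons z w)
  then show ?case
    using abs_endpt_le_length[of w] by (cases x; cases z) auto
qed simp

lemma endpt_replicate [simp]: "endpt (replicate n x) = step x * int n"
  by (induction n) (auto simp: algebra_simps)

lemma hi_replicate [simp]: "hi (replicate n x) = max 0 (step x * int n)"
  by (cases x; induction n) auto

lemma lo_replicate [simp]: "lo (replicate n x) = min 0 (step x * int n)"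
  by (cases x; induction n) auto


section \<open>Normal forms\<close>

text \<open>If \<open>i + k \<le> j\<close>, the walk goes to one extreme of its range, then to the
  other, and from there back to the end point.\<close>

definition zigzag :: "letter \<Rightarrow> nat \<Rightarrow> nat \<Rightarrow> nat \<Rightarrow> word" where
  "zigzag x i j k = replicate i (letter_inv x) @ replicate j x @ replicate k (letter_inv x)"

lemma walk_zigzag:
  assumes "i + k \<le> j"
  shows "endpt (zigzag x i j k) = step x * (int j - int i - int k)"
    and "width (zigzag x i j k) = int j"
  using assms by (cases x; auto simp: zigzag_def)+

section \<open>Calculus of letter powers in \<open>fim\<close>\<close>

lemma fim_idem_commute: "(x * sinv x) * (y * sinv y) = (y * sinv y) * (x * sinv x)" for x y :: fim
  by transfer (use vagner_comm in simp)

text \<open>Negative powers of \<open>x\<close> are powers of \<open>letter_inv x\<close>, so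
  exponents stay natural numbers.\<close>

definition letpow :: "letter \<Rightarrow> nat \<Rightarrow> fim" where
  "letpow x n = proj (replicate n x)"

lemma letpow_add: "letpow x (m + n) = letpow x m * letpow x n"
  by (simp add: letpow_def replicate_add proj_append)

lemma letpow_0 [simp]: "letpow x 0 = 1"
  by (simp add: letpow_def proj_Nil)

lemma sinv_letpow: "sinv (letpow x n) = letpow (letter_inv x) n"
  unfolding letpow_def by (simp add: word_inv_def flip: proj_word_inv)

lemma proj_zigzag:
  "proj (zigzag x i j k) = letpow (letter_inv x) i * letpow x j * letpow (letter_inv x) k"
  by (simp add: zigzag_def proj_append letpow_def mult.assoc)

lemma letpow_cancel: "letpow x n * letpow (letter_inv x) n * letpow x n = letpow x n"
  using mult_sinv_mult[of "letpow x n"] by (simp add: sinv_letpow)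

lemma letpow_cancel_left:
  assumes "i \<le> j"
  shows "letpow x i * letpow (letter_inv x) i * letpow x j = letpow x j"
proof -
  obtain l where "j = i + l"
    using assms le_Suc_ex by blast
  then show ?thesis
    by (simp add: letpow_add letpow_cancel flip: mult.assoc)
qed

lemma letpow_cancel_right:
  assumes "i \<le> j"
  shows "letpow x j * (letpow (letter_inv x) i * letpow x i) = letpow x j"
proof -
  obtain l where "j = l + i"
    using assms by (metis add.commute le_Suc_ex)
  then show ?thesis
    using letpow_cancel[of x i] by (simp add: letpow_add mult.assoc)
qed

lemma letpow_idem_commute:
  "letpow x i * letpow (letter_inv x) i * (letpow (letter_inv x) k * letpow x k) =
   letpow (letter_inv x) k * letpow x k * (letpow x i * letpow (letter_inv x) i)"
  using fim_idem_commute[of "letpow x i" "letpow (letter_inv x) k"] by (simp add: sinv_letpow)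

text \<open>The last two steps go back and forth inside a range already covered. Algebraically, the
  idempotent they form commutes past another one and is absorbed by a spare \<open>x\<close>, which
  exists since \<open>i < j\<close>.\<close>

lemma letpow_turn_right:
  assumes "i < j"
  shows "letpow x j * letpow (letter_inv x) (Suc i) * letpow x 1 = letpow x j * letpow (letter_inv x) i"
proof -
  let ?y = "letter_inv x"
  obtain l where j: "j = l + 1 + i"
    using assms by (metis add.commute add.left_commute less_iff_Suc_add plus_1_eq_Suc)
  have "letpow x j * letpow ?y (Suc i) * letpow x 1 =
      letpow x (l + 1) * ((letpow x i * letpow ?y i) * (letpow ?y 1 * letpow x 1))"
    unfolding j Suc_eq_plus1 by (simp only: letpow_add mult.assoc)
  also have "\<dots> = letpow x l * ((letpow x 1 * letpow ?y 1 * letpow x 1) * (letpow x i * letpow ?y i))"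
    unfolding letpow_idem_commute by (simp only: letpow_add mult.assoc)
  also have "\<dots> = letpow x j * letpow ?y i"
    unfolding letpow_cancel j by (simp only: letpow_add mult.assoc)
  finally show ?thesis .
qed

lemma letpow_turn_left:
  assumes "i < j"
  shows "letpow x 1 * letpow (letter_inv x) (Suc i) * letpow x j = letpow (letter_inv x) i * letpow x j"
proof -
  let ?y = "letter_inv x"
  obtain l where j: "j = i + 1 + l"
    using assms by (metis add.right_neutral add_Suc_right add_Suc less_iff_Suc_add One_nat_def)
  have "letpow x 1 * letpow ?y (Suc i) * letpow x j =
      (letpow x 1 * letpow ?y 1) * (letpow ?y i * letpow x i) * letpow x (1 + l)"
    unfolding j Suc_eq_plus1_left by (simp only: letpow_add mult.assoc)
  also have "\<dots> = letpow ?y i * letpow x i * ((letpow x 1 * letpow ?y 1 * letpow x 1) * letpow x l)"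
    unfolding letpow_idem_commute by (simp only: letpow_add mult.assoc)
  also have "\<dots> = letpow ?y i * letpow x j"
    unfolding letpow_cancel j by (simp only: letpow_add mult.assoc)
  finally show ?thesis .
qed

section \<open>Appending a letter to a normal form\<close>

text \<open>The new letter lengthens the middle run if there is no final run; otherwise it cancels
  one letter of the final run.\<close>

lemma zigzag_snoc_same:
  assumes "i + k \<le> j"
  shows "\<exists>i' j' k'. i' + k' \<le> j' \<and> proj (zigzag x i j k @ [x]) = proj (zigzag x i' j' k')"
proof (cases k)
  case 0
  have "zigzag x i j k @ [x] = zigzag x i (Suc j) 0"
    by (simp add: zigzag_def 0 replicate_append_same)
  then show ?thesis
    using assms 0 by (intro exI[of _ i] exI[of _ "Suc j"] exI[of _ 0]) simp
next
  case (Suc l)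
  have "proj [x] = letpow x 1"
    by (simp add: letpow_def)
  then have "proj (zigzag x i j k @ [x]) = proj (zigzag x i j l)"
    using letpow_turn_right[of l j x] assms Suc
    by (simp add: proj_append proj_zigzag mult.assoc)
  then show ?thesis
    using assms Suc by (metis add_Suc_right Suc_leD)
qed

lemma zigzag_snoc_inv:
  assumes "i + k \<le> j"
  shows "\<exists>z i' j' k'. i' + k' \<le> j' \<and> proj (zigzag x i j k @ [letter_inv x]) = proj (zigzag z i' j' k')"
proof (cases "i + k = j")
  case False
  have "zigzag x i j k @ [letter_inv x] = zigzag x i j (Suc k)"
    by (simp add: zigzag_def replicate_append_same)
  then show ?thesis
    using assms False
    by (intro exI[of _ x] exI[of _ i] exI[of _ j] exI[of _ "Suc k"]) simp
next
  case j: True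
  let ?y = "letter_inv x"
  have y: "proj [?y] = letpow ?y 1"
    by (simp add: letpow_def)
  \<comment> \<open>The final run has no room to grow, but the element is a product of two commuting
    idempotents. Swapping them exchanges the roles of \<open>x\<close> and \<open>?y\<close>, so the
    new letter again follows the main direction.\<close>
  have *: "proj (zigzag x i j k) = letpow x k * letpow ?y k * (letpow ?y i * letpow x i)"
    using letpow_idem_commute[of x k i] j
    by (simp add: proj_zigzag letpow_add mult.assoc flip: j)
  show ?thesis
  proof (cases i)
    case 0
    then have "proj (zigzag x i j k @ [?y]) = proj (zigzag ?y k (Suc k) 0)"
      using * by (simp add: proj_append proj_zigzag y mult.assoc flip: letpow_add)
    then show ?thesis
      by (intro exI[of _ ?y] exI[of _ k] exI[of _ "Suc k"] exI[of _ 0]) simp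
  next
    case (Suc l)
    have "proj (zigzag x i j k @ [?y]) =
        letpow x k * letpow ?y k * (letpow ?y i * letpow x (Suc l) * letpow ?y 1)"
      using * by (simp add: proj_append y mult.assoc Suc)
    also have "letpow ?y i * letpow x (Suc l) * letpow ?y 1 = letpow ?y i * letpow x l"
      using letpow_turn_right[of l i ?y] Suc by simp
    finally have "proj (zigzag x i j k @ [?y]) = proj (zigzag ?y k (k + i) l)"
      by (simp add: proj_zigzag letpow_add mult.assoc)
    then show ?thesis
      using Suc by (intro exI[of _ ?y] exI[of _ k] exI[of _ "k + i"] exI[of _ l]) simp
  qed
qed

theorem normal_form:
  obtains x i j k where "i + k \<le> j" "proj w = proj (zigzag x i j k)"
proof -
  have "\<exists>x i j k. i + k \<le> j \<and> proj w = proj (zigzag x i j k)"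
  proof (induction w rule: rev_induct)
    case Nil
    show ?case
      by (intro exI[of _ Gen] exI[of _ 0]) (simp add: zigzag_def)
  next
    case (snoc z w)
    then obtain x i j k where *: "i + k \<le> j" "proj w = proj (zigzag x i j k)"
      by blast
    have w: "proj (w @ [z]) = proj (zigzag x i j k @ [z])"
      using * by (simp add: proj_append)
    have "z = x \<or> z = letter_inv x"
      by (cases x; cases z) auto
    then show ?case
      unfolding w using zigzag_snoc_same[OF *(1), of x] zigzag_snoc_inv[OF *(1), of x] by blast
  qed
  then show ?thesis using that by blast
qed


section \<open>Geodesics, conjugacy and the \<open>\<D>\<close>-relation\<close>

text \<open>Normal forms attain the lower bound, as
  \<open>i + j + k = 2 * j - (j - i - k)\<close>.\<close>

lemma Geo_iff: "w \<in> Geo \<longleftrightarrow> int (length w) = 2 * width w - \<bar>endpt w\<bar>"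
proof
  assume w: "w \<in> Geo"
  obtain x i j k where nf: "i + k \<le> j" "proj w = proj (zigzag x i j k)"
    by (rule normal_form)
  have "length w \<le> length (zigzag x i j k)"
    using w nf(2) by (simp add: Geo_def)
  also have "int \<dots> = 2 * width w - \<bar>endpt w\<bar>"
    unfolding proj_walk[OF nf(2)] walk_zigzag[OF nf(1)]
    using nf(1) by (cases x) (auto simp: zigzag_def)
  finally show "int (length w) = 2 * width w - \<bar>endpt w\<bar>"
    using length_lower_bound[of w] by simp
next
  assume w: "int (length w) = 2 * width w - \<bar>endpt w\<bar>"
  show "w \<in> Geo"
    unfolding Geo_def
  proof (intro CollectI allI impI)
    fix u assume "proj u = proj w"
    then show "length w \<le> length u"
      using w length_lower_bound[of u] proj_walk[of u w] by simp
  qed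
qed

lemma replicate_in_Geo: "replicate n x \<in> Geo"
  by (cases x) (simp_all add: Geo_iff)

section \<open>Conjugacy classes\<close>

text \<open>The first equation puts the range of \<open>u\<close>, translated by
  \<open>- endpt g\<close>, inside that of \<open>v\<close>; the second gives the reverse
  inclusion.\<close>

lemma conj_translate:
  assumes "sinv (proj g) * proj u * proj g = proj v" "proj g * proj v * sinv (proj g) = proj u"
  shows "endpt v = endpt u" "hi v = hi u - endpt g" "lo v = lo u - endpt g"
proof -
  have 1: "proj (word_inv g @ u @ g) = proj v" "proj (g @ v @ word_inv g) = proj u"
    using assms by (simp_all add: proj_append proj_word_inv mult.assoc)
  note 2 = proj_walk[OF 1(1)] proj_walk[OF 1(2)]
  show "endpt v = endpt u" "hi v = hi u - endpt g" "lo v = lo u - endpt g"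
    using 2 by auto
qed

lemma conjugate_walk:
  assumes "conjugate (proj u) (proj v)"
  shows "endpt v = endpt u" "width v = width u"
proof -
  obtain g where "sinv (proj g) * proj u * proj g = proj v" "proj g * proj v * sinv (proj g) = proj u"
    using assms surj_proj unfolding conjugate_def by (metis surjD)
  then show "endpt v = endpt u" "width v = width u"
    using conj_translate by auto
qed

lemma conjugate_refl: "conjugate b b" for b :: "'a::inverse_monoid"
proof -
  have "sinv (1::'a) = 1"
    using sinv_unique[of "1::'a" 1] by simp
  then show ?thesis
    unfolding conjugate_def by (intro exI[of _ 1]) simp
qed

lemma ConjGeo_eq_Geo: "ConjGeo = Geo"
proof -
  have "length w \<le> length u" if "w \<in> Geo" "conj_class (proj w) = conj_class (proj u)" for w u
  proof -
    have "conjugate (proj w) (proj u)"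
      using that(2) conjugate_refl[of "proj u"] by (auto simp: conj_class_def)
    then show ?thesis
      using that(1) conjugate_walk[of w u] length_lower_bound[of u] by (simp add: Geo_iff)
  qed
  then show ?thesis
    by (auto simp: ConjGeo_def)
qed

lemma conj_class_nontrivialI:
  assumes "sinv (proj g) * b * proj g = c" "proj g * c * sinv (proj g) = b" "endpt g \<noteq> 0"
  shows "conj_class b \<noteq> {b}"
proof -
  obtain u v where uv: "b = proj u" "c = proj v"
    using surj_proj by (metis surjD)
  have "hi v = hi u - endpt g"
    using conj_translate[of g u v] assms uv by simp
  then have "c \<noteq> b"
    using uv assms(3) proj_walk(2)[of v u] by auto
  moreover have "conjugate b c"
    using assms unfolding conjugate_def by blast
  ultimately show ?thesis
    by (auto simp: conj_class_def)
qed

text \<open>Conjugating by \<open>proj [x]\<close> defines the candidate conjugate, so only the way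
  back has to be checked. A single letter has nonzero end point and hence moves the range.\<close>

lemma conj_class_letter_nontrivialI:
  assumes "letpow x 1 * (letpow (letter_inv x) 1 * b * letpow x 1) * letpow (letter_inv x) 1 = b"
  shows "conj_class b \<noteq> {b}"
proof -
  have x: "proj [x] = letpow x 1"
    by (simp add: letpow_def)
  have "endpt [x] \<noteq> 0"
    by (cases x) auto
  then show ?thesis
    by (intro conj_class_nontrivialI[of "[x]" b, OF refl]) (simp_all only: x sinv_letpow assms not_False_eq_True)
qed

lemma conj_class_replicate: "conj_class (proj (replicate n x)) = {proj (replicate n x)}"
proof -
  have "c = proj (replicate n x)" if "conjugate (proj (replicate n x)) c" for c
  proof -
    obtain u where u: "c = proj u"
      using surj_proj by (metis surjD)
    obtain z i j k where nf: "i + k \<le> j" "c = proj (zigzag z i j k)"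
      using normal_form[of u] u by metis
    have "endpt (zigzag z i j k) = step x * int n" "width (zigzag z i j k) = int n"
      using conjugate_walk[of "replicate n x" "zigzag z i j k"] that nf(2) by (cases x; simp)+
    then have *: "step z * (int j - int i - int k) = step x * int n" "j = n"
      by (simp_all add: walk_zigzag[OF nf(1)])
    \<comment> \<open>The absolute end point equals the width, which leaves no room for outer runs.
      For \<open>n = 0\<close> the letter \<open>z\<close> is undetermined, but the word is
      empty.\<close>
    then have "i = 0" "k = 0" "n = 0 \<or> z = x"
      using nf(1) by (cases x; cases z; auto)+
    then show ?thesis
      using nf(2) *(2) by (auto simp: zigzag_def)
  qed
  then show ?thesis
    using conjugate_refl by (auto simp: conj_class_def)
qed

text \<open>Start and end point can both move one step within the range: in the direction of
  \<open>letter_inv x\<close> if \<open>i > 0\<close>, and otherwise in that of \<open>x\<close>,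
  where \<open>k > 0\<close> leaves room.\<close>

lemma conj_class_zigzag_nontrivial:
  assumes "i + k \<le> j" "i + k > 0"
  shows "conj_class (proj (zigzag x i j k)) \<noteq> {proj (zigzag x i j k)}"
proof (cases i)
  case (Suc l)
  let ?y = "letter_inv x"
  have "letpow ?y 1 * letpow x 1 * letpow ?y i = letpow ?y i"
    using letpow_cancel_left[of 1 i ?y] Suc by simp
  moreover have "letpow x j * letpow ?y k * letpow ?y 1 * letpow x 1 = letpow x j * letpow ?y k"
    using letpow_turn_right[of k j x] letpow_add[of ?y k 1] assms Suc by (simp add: mult.assoc)
  moreover have "letpow ?y 1 * (letpow x 1 * (letpow ?y i * letpow x j * letpow ?y k) * letpow ?y 1)
      * letpow x 1 = (letpow ?y 1 * letpow x 1 * letpow ?y i) *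
        (letpow x j * letpow ?y k * letpow ?y 1 * letpow x 1)"
    by (simp only: mult.assoc)
  ultimately have "letpow ?y 1 * (letpow x 1 * (letpow ?y i * letpow x j * letpow ?y k) * letpow ?y 1)
      * letpow x 1 = letpow ?y i * letpow x j * letpow ?y k"
    by (simp only: mult.assoc)
  then show ?thesis
    unfolding proj_zigzag by (intro conj_class_letter_nontrivialI[of ?y]) (simp only: letter_inv_letter_inv)
next
  case 0
  let ?y = "letter_inv x"
  have "letpow ?y k * (letpow x 1 * letpow ?y 1) = letpow ?y k"
    using letpow_cancel_right[of 1 k ?y] 0 assms by simp
  moreover have "letpow x 1 * (letpow ?y 1 * letpow ?y i) * letpow x j = letpow ?y i * letpow x j"
    using letpow_turn_left[of i j x] letpow_add[of ?y 1 i] assms 0 by (simp add: mult.assoc)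
  moreover have "letpow x 1 * (letpow ?y 1 * (letpow ?y i * letpow x j * letpow ?y k) * letpow x 1)
      * letpow ?y 1 = (letpow x 1 * (letpow ?y 1 * letpow ?y i) * letpow x j) *
        (letpow ?y k * (letpow x 1 * letpow ?y 1))"
    by (simp only: mult.assoc)
  ultimately have "letpow x 1 * (letpow ?y 1 * (letpow ?y i * letpow x j * letpow ?y k) * letpow x 1)
      * letpow ?y 1 = letpow ?y i * letpow x j * letpow ?y k"
    by simp
  then show ?thesis
    unfolding proj_zigzag by (rule conj_class_letter_nontrivialI)
qed

section \<open>Green's relation and the width\<close>

text \<open>A word followed or preceded by its inverse walks over a translate of its own
  range.\<close>

lemma green_D_width:
  assumes "(proj u, proj v) \<in> green_D"
  shows "width u = width v"
proof -
  obtain t where t: "(proj u, proj t) \<in> green_L" "(proj t, proj v) \<in> green_R"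
    using assms surj_proj unfolding green_D_def by (metis relcompE prod.inject surjD)
  have 1: "proj (word_inv u @ u) = proj (word_inv t @ t)" "proj (t @ word_inv t) = proj (v @ word_inv v)"
    using t by (simp_all add: green_L_def green_R_def proj_append proj_word_inv)
  show ?thesis
    using proj_walk[OF 1(1)] proj_walk[OF 1(2)] by simp
qed

text \<open>The intermediate element \<open>?d\<close> drops the initial run, which stays in the
  \<open>green_L\<close> class; dropping the final run then stays in the \<open>green_R\<close>
  class.\<close>

lemma zigzag_green_D_replicate:
  assumes "i + k \<le> j"
  shows "(proj (zigzag x i j k), proj (replicate j x)) \<in> green_D"
proof -
  let ?y = "letter_inv x"
  let ?d = "letpow x j * letpow ?y k"
  have d: "?d = proj (zigzag x 0 j k)"
    by (simp add: proj_zigzag)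
  have sinv_zigzag: "sinv (proj (zigzag x l j k)) = letpow x k * letpow ?y j * letpow x l" for l
    unfolding proj_word_inv[symmetric]
    by (simp add: zigzag_def word_inv_def proj_append letpow_def mult.assoc)
  have L: "(proj (zigzag x i j k), ?d) \<in> green_L"
    unfolding green_L_def d using letpow_cancel_left[of i j x] assms
    by (simp add: sinv_zigzag) (simp add: proj_zigzag mult.assoc, metis mult.assoc)
  have "letpow ?y k * letpow x k * letpow ?y j = letpow ?y j"
    using letpow_cancel_left[of k j ?y] assms by simp
  then have R: "(?d, proj (replicate j x)) \<in> green_R"
    unfolding green_R_def d
    by (simp add: sinv_zigzag sinv_letpow flip: letpow_def) (simp add: proj_zigzag mult.assoc)
  show ?thesis
    unfolding green_D_def using L R by blast
qed

section \<open>The languages \<open>DGeo\<close> and \<open>UConjGeo\<close>\<close>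

text \<open>The geodesic length equals the absolute end point, so every step goes the same
  way.\<close>

lemma Geo_zigzag_0:
  assumes "w \<in> Geo" "proj w = proj (zigzag x 0 j 0)"
  shows "w = replicate j x"
proof -
  have "endpt w = step x * int j" "width w = int j"
    using walk_zigzag[of 0 0 j x] proj_walk[OF assms(2)] by simp_all
  then have "length w = j" "endpt w = step x * int (length w)"
    using assms(1) by (cases x; simp add: Geo_iff)+
  then show ?thesis
    using eq_replicate_if_endpt by blast
qed

lemma length_Geo_zigzag:
  assumes "w \<in> Geo" "i + k \<le> j" "proj w = proj (zigzag x i j k)"
  shows "length w = i + j + k"
proof -
  have "int (length w) = int (i + j + k)"
    using assms walk_zigzag[OF assms(2), of x] proj_walk[OF assms(3)]
    by (cases x) (auto simp: Geo_iff)
  then show ?thesis by simp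
qed

lemma DGeo_subset_Geo: "DGeo \<subseteq> Geo"
proof -
  have "(b, b) \<in> green_D" for b :: fim
    by (auto simp: green_D_def green_L_def green_R_def)
  then show ?thesis
    by (auto simp: DGeo_def Geo_def)
qed

lemma DGeo_eq: "DGeo = {replicate n x | n x. True}"
proof (intro equalityI subsetI)
  fix w assume w: "w \<in> DGeo"
  then have geo: "w \<in> Geo"
    using DGeo_subset_Geo by blast
  obtain x i j k where nf: "i + k \<le> j" "proj w = proj (zigzag x i j k)"
    by (rule normal_form)
  have "length w \<le> j"
    using w zigzag_green_D_replicate[OF nf(1), of x] nf(2) by (auto simp: DGeo_def)
  then have "i = 0" "k = 0"
    using length_Geo_zigzag[OF geo nf] by auto
  then show "w \<in> {replicate n x | n x. True}"
    using Geo_zigzag_0[OF geo, of x j] nf(2) by blast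
next
  fix w :: word assume "w \<in> {replicate n x | n x. True}"
  then obtain n x where w: "w = replicate n x" by blast
  have "n \<le> length u" if "(proj w, proj u) \<in> green_D" for u
    using green_D_width[OF that] width_le_length[of u] unfolding w by (cases x) auto
  then show "w \<in> DGeo"
    by (simp add: DGeo_def w)
qed

lemma UConjGeo_eq: "UConjGeo = {replicate n x | n x. True} \<union> {[Gen, GenInv], [GenInv, Gen]}"
  (is "_ = ?R \<union> ?T")
proof (intro equalityI subsetI)
  have T: "w \<in> Geo \<and> conj_class (proj w) \<noteq> {proj w}" if w: "w \<in> ?T" for w
  proof
    show "w \<in> Geo"
      using w by (auto simp: Geo_iff)
    have "w = zigzag Gen 0 1 1 \<or> w = zigzag GenInv 0 1 1"
      using w by (auto simp: zigzag_def)
    then show "conj_class (proj w) \<noteq> {proj w}"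
      using conj_class_zigzag_nontrivial[of 0 1 1] by auto
  qed
  {
    fix w assume w: "w \<in> UConjGeo"
    then have geo: "w \<in> Geo"
      by (simp add: UConjGeo_def)
    obtain x i j k where nf: "i + k \<le> j" "proj w = proj (zigzag x i j k)"
      by (rule normal_form)
    show "w \<in> ?R \<union> ?T"
    proof (cases "i + k = 0")
      case True
      then show ?thesis
        using Geo_zigzag_0[OF geo, of x j] nf(2) by auto
    next
      case False
      then have "(proj w, proj [Gen, GenInv]) \<in> UConj"
        using T[of "[Gen, GenInv]"] conj_class_zigzag_nontrivial[OF nf(1), of x] nf(2)
        by (simp add: UConj_def)
      then have "length w \<le> 2"
        using w T[of "[Gen, GenInv]"] by (auto simp: UConjGeo_def)
      \<comment> \<open>The length is \<open>i + j + k \<le> 2\<close>, while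
        \<open>0 < i + k \<le> j\<close>.\<close>
      then have "i + k = 1" "j = 1" "length w = 2"
        using length_Geo_zigzag[OF geo nf] False nf(1) by linarith+
      moreover from this have "endpt w = 0"
        using walk_zigzag(1)[OF nf(1), of x] proj_walk(1)[OF nf(2)] by (cases x) auto
      ultimately obtain y z where "w = [y, z]" "step y + step z = 0"
        by (auto simp: length_Suc_conv numeral_2_eq_2)
      then show ?thesis
        by (cases y; cases z) auto
    qed
  next
    fix w :: word assume w: "w \<in> ?R \<union> ?T"
    then have geo: "w \<in> Geo"
      using T replicate_in_Geo by auto
    have "length w \<le> length u" if u: "u \<in> Geo" "(proj w, proj u) \<in> UConj" for u
    proof (cases "proj w = proj u")
      case True
      then show ?thesis
        using geo by (simp add: Geo_def)
    next
      case False
      then have nontriv: "conj_class (proj w) \<noteq> {proj w}" "conj_class (proj u) \<noteq> {proj u}"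
        using u(2) by (auto simp: UConj_def)
      then have "w \<in> ?T"
        using w conj_class_replicate by auto
      \<comment> \<open>Shorter words are powers of a letter, whose classes are trivial.\<close>
      moreover have "length u \<ge> 2"
      proof (rule ccontr)
        assume "\<not> length u \<ge> 2"
        then have "u = [] \<or> (\<exists>x. u = [x])"
          by (cases u; cases "tl u") auto
        then have "\<exists>n x. u = replicate n x"
          by (metis replicate_0 replicate_Suc)
        then show False
          using nontriv conj_class_replicate by auto
      qed
      ultimately show ?thesis by auto
    qed
    then show "w \<in> UConjGeo"
      using geo by (simp add: UConjGeo_def)
  }
qed


section \<open>The automaton\<close>

text \<open>State 0 is initial, 1 and 2 record a first letter, 3 and 4 are reached by powers of
  length at least 2, 5 by the two exceptional words, and 6 is the only rejecting state.\<close>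

fun aut :: "nat \<Rightarrow> letter \<Rightarrow> nat" where
  "aut q Gen = (if q = 0 then 1 else if q = 1 \<or> q = 3 then 3 else if q = 2 then 5 else 6)"
| "aut q GenInv = (if q = 0 then 2 else if q = 2 \<or> q = 4 then 4 else if q = 1 then 5 else 6)"

lemma foldl_aut_6: "foldl aut 6 w = 6"
proof (induction w)
  case (Cons x w)
  then show ?case by (cases x) auto
qed simp

lemma foldl_aut_5: "foldl aut 5 w = (if w = [] then 5 else 6)"
proof (cases w)
  case (Cons x w')
  then show ?thesis by (cases x) (auto simp: foldl_aut_6)
qed simp

lemma foldl_aut_3: "foldl aut 3 w = (if set w \<subseteq> {Gen} then 3 else 6)"
proof (induction w)
  case (Cons x w)
  then show ?case by (cases x) (auto simp: foldl_aut_6)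
qed simp

lemma foldl_aut_4: "foldl aut 4 w = (if set w \<subseteq> {GenInv} then 4 else 6)"
proof (induction w)
  case (Cons x w)
  then show ?case by (cases x) (auto simp: foldl_aut_6)
qed simp

text \<open>Puts powers in the form in which acceptance from states 3 and 4 is described.\<close>

lemma power_iff_set: "(\<exists>n x. w = replicate n x) \<longleftrightarrow> set w \<subseteq> {Gen} \<or> set w \<subseteq> {GenInv}"
proof
  assume "\<exists>n x. w = replicate n x"
  then obtain n x where "w = replicate n x" by blast
  then show "set w \<subseteq> {Gen} \<or> set w \<subseteq> {GenInv}"
    by (cases x) (auto simp: set_replicate_conv_if)
next
  assume "set w \<subseteq> {Gen} \<or> set w \<subseteq> {GenInv}"
  then have "w = replicate (length w) Gen \<or> w = replicate (length w) GenInv"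
    by (metis replicate_eqI singletonD subsetD)
  then show "\<exists>n x. w = replicate n x" by blast
qed

lemma aut_accepts:
  "foldl aut 0 w \<in> {0..5} \<longleftrightarrow> (\<exists>n x. w = replicate n x) \<or> w \<in> {[Gen, GenInv], [GenInv, Gen]}"
proof -
  \<comment> \<open>Two letters always lead to state 3, 4 or 5, from which all runs are
    known.\<close>
  consider "w = []" | x where "w = [x]" | x y v where "w = x # y # v"
    by (metis list.exhaust)
  then show ?thesis
  proof cases
    case 2
    then show ?thesis unfolding power_iff_set by (cases x) auto
  next
    case 3
    then show ?thesis
      unfolding power_iff_set
      by (cases x; cases y) (auto simp: foldl_aut_3 foldl_aut_4 foldl_aut_5)
  qed (simp add: power_iff_set)
qed

lemma regular_UConjGeo: "regular_language UConjGeo"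
  unfolding regular_language_def
proof (intro exI conjI)
  show "finite {0..6::nat}" "(0::nat) \<in> {0..6}" "{0..5::nat} \<subseteq> {0..6}"
    by auto
  show "\<forall>q\<in>{0..6}. \<forall>x. aut q x \<in> {0..6}"
  proof (intro ballI allI)
    show "aut q x \<in> {0..6}" for q x
      by (cases x) auto
  qed
  show "UConjGeo = {w. foldl aut 0 w \<in> {0..5}}"
    unfolding aut_accepts UConjGeo_eq by auto
qed

theorem proposition4p5:
  "ConjGeo = Geo \<and>
   UConjGeo = DGeo \<union> {[Gen, GenInv], [GenInv, Gen]} \<and>
   regular_language UConjGeo"
  using ConjGeo_eq_Geo UConjGeo_eq DGeo_eq regular_UConjGeo by simp

end
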